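(* Let $m$ be a positive integer, and let $D$ be a nonnegative integer valued random variable with $\mathbb{P}(D\ge m)>0$. The following are equivalent: (i) The distribution of $D$ is fixed by the transformation $D\mapsto T_{p,m}D$ for all $p\in(0,1)$, i.e. for every $p\in(0,1)$ the random variable $T_{p,m}D$ has the same distribution as $D$. (ii) Either $D\equiv m$ is constant (i.e. $\mathbb{P}(D=m)=1$), or else there exists $\alpha$ with $0<\alpha<m$ such that, with $\beta=\alpha+1$, $D$ has power-law-$\beta$ distribution in the sense that $\mathbb{P}(D=k)\sim c\,k^{-\beta}$ as $k\to\infty$ for some constant $c>0$, $\mathbb{P}(D<m)=0$, and $$\frac{\mathbb{P}(D=k+1)}{\mathbb{P}(D=k)}=\frac{k-\alpha}{k+1}\quad\text{for all integers } k\ge m.$$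
   Context: For a nonnegative integer valued random variable $D$ and $p\in(0,1)$, the $p$-thinning of $D$ is $S_D=\sum_{i=1}^{D}X_i$, where $X_1,X_2,\dots$ are i.i.d. Bernoulli($p$) random variables (so $\mathbb{P}(X_i=1)=p$, $\mathbb{P}(X_i=0)=1-p$) independent of $D$. For a positive integer $m$, the transformation $T_{p,m}$ sends $D$ to a random variable $T_{p,m}D$ whose distribution is that of $S_D$ conditioned on $S_D\ge m$: $\mathbb{P}(T_{p,m}D=l)=\mathbb{P}(S_D=l\mid S_D\ge m)$. It is defined when $\mathbb{P}(D\ge m)>0$. *)

theory Defs
  imports "HOL-Probability.Probability"
begin

text \<open>
  The probability space carrying \<open>D\<close> need not carry an independent Bernoulli sequence, so it is
  extended by one. A point of the extended space is a pair \<open>(\<omega>, X)\<close>, where \<open>X 0, X 1, \<dots>\<close> are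
  i.i.d.\ Bernoulli(\<open>p\<close>) (\<open>True\<close> meaning 1) and independent of \<open>\<omega>\<close>.
  Note that \<open>bernoulli_pmf p\<close> clamps \<open>p\<close> to \<open>[0, 1]\<close>.
\<close>

definition thinning_space :: "'a measure \<Rightarrow> real \<Rightarrow> ('a \<times> (nat \<Rightarrow> bool)) measure" where
  "thinning_space M p = M \<Otimes>\<^sub>M (\<Pi>\<^sub>M i\<in>UNIV. measure_pmf (bernoulli_pmf p))"

definition thinning :: "('a \<Rightarrow> nat) \<Rightarrow> 'a \<times> (nat \<Rightarrow> bool) \<Rightarrow> nat" where
  "thinning D = (\<lambda>(\<omega>, X). \<Sum>i<D \<omega>. of_bool (X i))"

text \<open>
  The distribution of \<open>T\<^bsub>p,m\<^esub> D\<close>; meaningful only if \<open>D \<ge> m\<close> has positive probability.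
\<close>

definition T_distr :: "real \<Rightarrow> nat \<Rightarrow> 'a measure \<Rightarrow> ('a \<Rightarrow> nat) \<Rightarrow> nat measure" where
  "T_distr p m M D =
     distr (uniform_measure (thinning_space M p)
             {x \<in> space (thinning_space M p). thinning D x \<ge> m})
       (count_space UNIV) (thinning D)"

definition has_power_law :: "'a measure \<Rightarrow> ('a \<Rightarrow> nat) \<Rightarrow> real \<Rightarrow> bool" where
  "has_power_law M D \<beta> \<longleftrightarrow>
     (\<exists>c>0. (\<lambda>k. \<P>(\<omega> in M. D \<omega> = k)) \<sim>[at_top] (\<lambda>k. c * real k powr (- \<beta>)))"

lemma prob_space_thinning_space:
  assumes "prob_space M"
  shows "prob_space (thinning_space M p)"
proof -
  interpret M: prob_space M by fact
  interpret B: prob_space "\<Pi>\<^sub>M i\<in>(UNIV :: nat set). measure_pmf (bernoulli_pmf p)"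
    by (intro prob_space_PiM prob_space_measure_pmf)
  interpret P: pair_prob_space M "\<Pi>\<^sub>M i\<in>(UNIV :: nat set). measure_pmf (bernoulli_pmf p)" ..
  show ?thesis
    unfolding thinning_space_def by (rule P.prob_space_axioms)
qed

lemma measurable_thinning:
  assumes [measurable]: "D \<in> M \<rightarrow>\<^sub>M count_space UNIV"
  shows "thinning D \<in> thinning_space M p \<rightarrow>\<^sub>M count_space UNIV"
proof -
  let ?B = "\<Pi>\<^sub>M i\<in>(UNIV :: nat set). measure_pmf (bernoulli_pmf p)"
  have proj: "(\<lambda>X. X i) \<in> ?B \<rightarrow>\<^sub>M count_space UNIV" for i
    using measurable_component_singleton[of i UNIV "\<lambda>_. measure_pmf (bernoulli_pmf p)"]
    by (simp add: measurable_cong_sets[OF refl sets_measure_pmf_count_space])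
  have *: "(\<lambda>x. of_bool (snd x i) :: nat) \<in> (M \<Otimes>\<^sub>M ?B) \<rightarrow>\<^sub>M count_space UNIV" for i
    by (rule measurable_compose[OF measurable_compose[OF measurable_snd proj]]) simp
  have sum: "(\<lambda>x. \<Sum>i<n. of_bool (snd x i) :: nat) \<in> (M \<Otimes>\<^sub>M ?B) \<rightarrow>\<^sub>M count_space UNIV" for n
  proof (induction n)
    case (Suc n)
    note [measurable] = Suc *[of n]
    show ?case
      by (simp only: sum.lessThan_Suc) measurable
  qed simp
  have "(\<lambda>x. D (fst x)) \<in> (M \<Otimes>\<^sub>M ?B) \<rightarrow>\<^sub>M count_space UNIV"
    by measurable
  from measurable_compose_countable[OF sum this]
  have "(\<lambda>x. \<Sum>i<D (fst x). of_bool (snd x i) :: nat) \<in> (M \<Otimes>\<^sub>M ?B) \<rightarrow>\<^sub>M count_space UNIV"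
    by simp
  then show ?thesis
    by (simp add: thinning_space_def thinning_def case_prod_beta)
qed

lemma measure_T_distr:
  assumes "prob_space M" and D: "D \<in> M \<rightarrow>\<^sub>M count_space UNIV"
  shows "measure (T_distr p m M D) {l} =
    \<P>(x in thinning_space M p. thinning D x = l \<bar> thinning D x \<ge> m)"
proof -
  interpret prob_space "thinning_space M p"
    using assms(1) by (rule prob_space_thinning_space)
  note [measurable] = measurable_thinning[OF D, of p]
  have "measure (T_distr p m M D) {l} =
    \<P>(x in uniform_measure (thinning_space M p)
         {x \<in> space (thinning_space M p). thinning D x \<ge> m}. thinning D x = l)"
    unfolding T_distr_def
    by (subst measure_distr) (auto intro!: arg_cong[where f = "measure _"])
  also have "\<dots> = \<P>(x in thinning_space M p. thinning D x = l \<bar> thinning D x \<ge> m)"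
    by (intro measure_uniform_measure_eq_cond_prob) measurable
  finally show ?thesis .
qed

end

theory Submission
  imports
    Defs
    "HOL-Complex_Analysis.Cauchy_Integral_Formula"
    "HOL-Real_Asymp.Real_Asymp"
begin

text \<open>
  Write \<open>d n\<close> for \<open>P(D = n)\<close>. Conditioning only rescales, so \<open>D\<close> is fixed by \<open>T\<^bsub>p,m\<^esub>\<close> iff \<open>d\<close>
  vanishes below \<open>m\<close> and thinning multiplies each \<open>d l\<close>, \<open>l \<ge> m\<close>, by one number \<open>c p\<close> that does
  not depend on \<open>l\<close>. The claim is that, for \<open>d\<close> vanishing below \<open>m\<close>, the latter holds for all \<open>p\<close> iff
  \<open>(k + 1) d (k + 1) = (k - \<alpha>) d k\<close> for all \<open>k \<ge> m\<close>, for some \<open>\<alpha> \<le> m\<close>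
  (lemma \<open>thinning_fixed_iff_recurrence\<close>).

  If the recurrence holds, then \<open>d (l + j) * (l + j choose l)\<close> is \<open>d l\<close> times the \<open>j\<close>-th coefficient
  of the negative binomial series \<open>(1 - q) powr (\<alpha> - l)\<close>. Evaluating at \<open>q = 1 - p\<close> gives
  \<open>P(S\<^sub>D = l) = p powr \<alpha> * d l\<close>, so \<open>c p = p powr \<alpha>\<close> works
  (lemma \<open>thinned_recurrence_sums\<close>).

  Conversely, put \<open>G\<^sub>l(q) = (\<Sum>j. d (l + j) * (l + j choose l) * q ^ j)\<close>, so that
  \<open>P(S\<^sub>D = l) = p ^ l * G\<^sub>l(1 - p)\<close>. The unknown factor \<open>c p\<close> can be eliminated using only the two
  values \<open>l = m\<close> and \<open>l = m + 1\<close>, which leaves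
  \<open>d m * (1 - q) * G\<^bsub>m+1\<^esub>(q) = d (m + 1) * G\<^sub>m(q)\<close>. In terms of the probability generating function
  \<open>f\<close> of \<open>D\<close>, \<open>G\<^sub>l\<close> is \<open>f\<close> differentiated \<open>l\<close> times and divided by \<open>l!\<close>, so this is a
  differential equation \<open>(1 - q) g' = r g\<close> for the \<open>m\<close>-th derivative \<open>g\<close> of \<open>f\<close>. Comparing coefficients
  yields the recurrence with \<open>\<alpha> = m - r\<close>, where \<open>r = (m + 1) * d (m + 1) / d m\<close>
  (lemma \<open>recurrence_of_thinned_proportional\<close>).

  It remains to read off the two alternatives from the recurrence. For \<open>\<alpha> = m\<close> all probabilities
  after \<open>d m\<close> vanish and \<open>D\<close> is constant. For \<open>\<alpha> < m\<close> the solution is a quotient of Pochhammer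
  symbols, which behaves like \<open>k powr (- (\<alpha> + 1))\<close> by Euler's limit for the Gamma function
  (lemma \<open>recurrence_power_law\<close>). Finally \<open>\<alpha> > 0\<close>, as otherwise \<open>d\<close> would dominate a multiple of
  the harmonic series (lemma \<open>recurrence_pos_exponent\<close>).
\<close>

section \<open>The distribution of a thinning\<close>

abbreviation bernoulli_seq :: "real \<Rightarrow> (nat \<Rightarrow> bool) measure" where
  "bernoulli_seq p \<equiv> \<Pi>\<^sub>M i\<in>UNIV. measure_pmf (bernoulli_pmf p)"

text \<open>
  The event depends on \<open>X 0, \<dots>, X (n - 1)\<close> only and splits into one cylinder for each \<open>l\<close>-element
  set of success times; all these cylinders have the same probability.
\<close>

lemma bernoulli_seq_binomial:
  assumes p: "0 \<le> p" "p \<le> 1"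
  shows "{X. (\<Sum>i<n. of_bool (X i)) = l} \<in> sets (bernoulli_seq p)" (is "?E \<in> _")
    and "measure (bernoulli_seq p) {X. (\<Sum>i<n. of_bool (X i)) = l} =
      real (n choose l) * p ^ l * (1 - p) ^ (n - l)"
proof -
  interpret product_prob_space "\<lambda>_ :: nat. measure_pmf (bernoulli_pmf p)" UNIV
    by (intro product_prob_spaceI prob_space_measure_pmf)
  define \<S> where "\<S> = {A. A \<subseteq> {..<n} \<and> card A = l}"
  define cyl where "cyl A = {X :: nat \<Rightarrow> bool. \<forall>i<n. X i \<longleftrightarrow> i \<in> A}" for A
  have cyl_emb: "cyl A =
      prod_emb UNIV (\<lambda>_. measure_pmf (bernoulli_pmf p)) {..<n} (Pi\<^sub>E {..<n} (\<lambda>i. {i \<in> A}))" for A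
    by (simp add: cyl_def prod_emb_def PiE_UNIV_domain PiE_def Pi_def extensional_def vimage_def)
  have sets_cyl: "cyl A \<in> sets (bernoulli_seq p)" for A
    unfolding cyl_emb by (intro sets_PiM_I) auto
  have fin: "finite \<S>"
    by (rule finite_subset[of _ "Pow {..<n}"]) (auto simp: \<S>_def)
  have E_eq: "?E = (\<Union>A\<in>\<S>. cyl A)"
  proof (intro equalityI subsetI)
    fix X assume "X \<in> ?E"
    then have "{..<n} \<inter> {i. X i} \<in> \<S>" "X \<in> cyl ({..<n} \<inter> {i. X i})"
      by (auto simp: \<S>_def cyl_def)
    then show "X \<in> (\<Union>A\<in>\<S>. cyl A)" by blast
  next
    fix X assume "X \<in> (\<Union>A\<in>\<S>. cyl A)"
    then obtain A where A: "A \<subseteq> {..<n}" "card A = l" "X \<in> cyl A" by (auto simp: \<S>_def)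
    then have "{..<n} \<inter> {i. X i} = A" by (auto simp: cyl_def)
    with A show "X \<in> ?E" by simp
  qed
  show "?E \<in> sets (bernoulli_seq p)"
    unfolding E_eq using fin sets_cyl by auto
  have disj: "disjoint_family_on cyl \<S>"
    unfolding disjoint_family_on_def
  proof (intro ballI impI)
    fix A B assume AB: "A \<in> \<S>" "B \<in> \<S>" "A \<noteq> B"
    have "A = {..<n} \<inter> {i. X i}" if "X \<in> cyl A" "A \<in> \<S>" for A X
      using that by (auto simp: cyl_def \<S>_def)
    with AB show "cyl A \<inter> cyl B = {}" by blast
  qed
  have meas: "measure (bernoulli_seq p) (cyl A) = p ^ l * (1 - p) ^ (n - l)" if "A \<in> \<S>" for A
  proof -
    have A: "A \<subseteq> {..<n}" "card A = l" using that by (auto simp: \<S>_def)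
    have "measure (bernoulli_seq p) (cyl A) = (\<Prod>i<n. pmf (bernoulli_pmf p) (i \<in> A))"
      unfolding cyl_emb by (subst measure_PiM_emb) (auto simp: measure_pmf_single)
    also have "\<dots> = (\<Prod>i<n. if i \<in> A then p else 1 - p)"
      using p by (intro prod.cong) auto
    also have "\<dots> = p ^ card A * (1 - p) ^ card ({..<n} - A)"
      using A by (simp add: prod.If_cases Int_absorb1 Diff_eq[symmetric])
    also have "card ({..<n} - A) = n - l"
      using A by (subst card_Diff_subset) (auto intro: finite_subset)
    finally show ?thesis using A by simp
  qed
  have "measure (bernoulli_seq p) ?E = (\<Sum>A\<in>\<S>. measure (bernoulli_seq p) (cyl A))"
    unfolding E_eq using fin sets_cyl disj by (intro P.finite_measure_finite_Union) auto
  also have "\<dots> = real (card \<S>) * (p ^ l * (1 - p) ^ (n - l))"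
    using meas by simp
  also have "card \<S> = n choose l"
    unfolding \<S>_def using n_subsets[of "{..<n}" l] by simp
  finally show "measure (bernoulli_seq p) ?E = real (n choose l) * p ^ l * (1 - p) ^ (n - l)"
    by simp
qed

text \<open>
  The law of total probability over the values of \<open>D\<close>: on \<open>D = n\<close> the thinning is a sum of
  \<open>n\<close> Bernoulli variables.
\<close>

lemma thinning_sums:
  assumes "prob_space M" and D: "D \<in> M \<rightarrow>\<^sub>M count_space UNIV" and p: "0 \<le> p" "p \<le> 1"
  shows "(\<lambda>n. \<P>(\<omega> in M. D \<omega> = n) * (real (n choose l) * p ^ l * (1 - p) ^ (n - l)))
    sums \<P>(x in thinning_space M p. thinning D x = l)"
proof -
  interpret M: prob_space M by fact
  interpret B: prob_space "bernoulli_seq p"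
    by (intro prob_space_PiM prob_space_measure_pmf)
  interpret P: pair_prob_space M "bernoulli_seq p" ..
  define E where "E n = {X :: nat \<Rightarrow> bool. (\<Sum>i<n. of_bool (X i)) = l}" for n
  define F where "F n = {\<omega> \<in> space M. D \<omega> = n}" for n
  note [measurable] = D
  have sE: "E n \<in> sets (bernoulli_seq p)" for n
    unfolding E_def using p by (rule bernoulli_seq_binomial)
  have sF: "F n \<in> sets M" for n
    unfolding F_def by measurable
  have ev: "{x \<in> space (thinning_space M p). thinning D x = l} = (\<Union>n. F n \<times> E n)"
    by (auto simp: thinning_space_def thinning_def space_pair_measure space_PiM E_def F_def)
  have "(\<lambda>n. measure (M \<Otimes>\<^sub>M bernoulli_seq p) (F n \<times> E n))
      sums measure (M \<Otimes>\<^sub>M bernoulli_seq p) (\<Union>n. F n \<times> E n)"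
    using sE sF by (intro P.P.finite_measure_UNION) (auto simp: disjoint_family_on_def F_def)
  moreover have "measure (M \<Otimes>\<^sub>M bernoulli_seq p) (F n \<times> E n) =
      measure M (F n) * measure (bernoulli_seq p) (E n)" for n
    using sE sF by (simp add: measure_def B.emeasure_pair_measure_Times enn2real_mult)
  ultimately show ?thesis
    unfolding ev using bernoulli_seq_binomial(2)[OF p]
    by (simp add: E_def F_def thinning_space_def)
qed

lemma prob_ge_sums:
  assumes "prob_space M" and D: "D \<in> M \<rightarrow>\<^sub>M count_space UNIV"
  shows "(\<lambda>j. \<P>(\<omega> in M. D \<omega> = m + j)) sums \<P>(\<omega> in M. D \<omega> \<ge> (m :: nat))"
proof -
  interpret M: prob_space M by fact
  note [measurable] = D
  have "{\<omega> \<in> space M. D \<omega> \<ge> m} = (\<Union>j. {\<omega> \<in> space M. D \<omega> = m + j})"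
    by (auto simp: le_iff_add)
  then show ?thesis
    by (simp only:) (intro M.finite_measure_UNION, auto simp: disjoint_family_on_def)
qed

text \<open>
  Conditioning on the thinning being at least \<open>m\<close> kills its masses below \<open>m\<close> and divides the
  others by the same number, so only singletons need to be compared.
\<close>

lemma thinning_fixed_iff:
  assumes M: "prob_space M" and D: "D \<in> M \<rightarrow>\<^sub>M count_space UNIV"
    and pos: "\<P>(x in thinning_space M p. thinning D x \<ge> m) > 0"
  shows "T_distr p m M D = distr M (count_space UNIV) D \<longleftrightarrow>
    (\<forall>l<m. \<P>(\<omega> in M. D \<omega> = l) = 0) \<and>
    (\<forall>l\<ge>m. \<P>(x in thinning_space M p. thinning D x = l) =
       \<P>(x in thinning_space M p. thinning D x \<ge> m) * \<P>(\<omega> in M. D \<omega> = l))"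
proof -
  interpret M: prob_space M by fact
  interpret T: prob_space "thinning_space M p"
    using M by (rule prob_space_thinning_space)
  note [measurable] = D measurable_thinning[OF D, of p]
  let ?c = "\<P>(x in thinning_space M p. thinning D x \<ge> m)"
  let ?U = "uniform_measure (thinning_space M p)
    {x \<in> space (thinning_space M p). thinning D x \<ge> m}"
  interpret U: prob_space ?U
    using pos by (intro prob_space_uniform_measure) (auto simp: T.emeasure_eq_measure)
  have "prob_space (T_distr p m M D)"
    unfolding T_distr_def by (intro U.prob_space_distr) simp
  then interpret T': prob_space "T_distr p m M D" .
  interpret D': prob_space "distr M (count_space UNIV) D"
    by (intro M.prob_space_distr) simp
  have T_l: "measure (T_distr p m M D) {l} =
      (if l < m then 0 else \<P>(x in thinning_space M p. thinning D x = l) / ?c)" for l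
  proof -
    have "{x \<in> space (thinning_space M p). thinning D x = l \<and> thinning D x \<ge> m} =
        (if l < m then {} else {x \<in> space (thinning_space M p). thinning D x = l})"
      by auto
    then show ?thesis
      unfolding measure_T_distr[OF M D] cond_prob_def by simp
  qed
  have D_l: "measure (distr M (count_space UNIV) D) {l} = \<P>(\<omega> in M. D \<omega> = l)" for l
    by (subst measure_distr) (auto intro!: arg_cong[where f = "measure _"])
  have "T_distr p m M D = distr M (count_space UNIV) D \<longleftrightarrow>
      (\<forall>l. measure (T_distr p m M D) {l} = measure (distr M (count_space UNIV) D) {l})"
  proof
    assume "\<forall>l. measure (T_distr p m M D) {l} = measure (distr M (count_space UNIV) D) {l}"
    then show "T_distr p m M D = distr M (count_space UNIV) D"
      by (intro measure_eqI_countable[where A = UNIV])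
        (simp_all add: T'.emeasure_eq_measure D'.emeasure_eq_measure, simp_all add: T_distr_def)
  qed simp
  also have "\<dots> \<longleftrightarrow> (\<forall>l. (if l < m then 0 else \<P>(x in thinning_space M p. thinning D x = l) / ?c)
      = \<P>(\<omega> in M. D \<omega> = l))"
    by (simp only: T_l D_l)
  also have "\<dots> \<longleftrightarrow> (\<forall>l<m. \<P>(\<omega> in M. D \<omega> = l) = 0) \<and>
    (\<forall>l\<ge>m. \<P>(x in thinning_space M p. thinning D x = l) = ?c * \<P>(\<omega> in M. D \<omega> = l))"
    using pos by (intro iffI conjI allI impI) (fastforce simp: not_less field_simps split: if_splits)+
  finally show ?thesis .
qed

section \<open>Power series on the unit interval\<close>

text \<open>
  The identity theorem for power series that are known to agree to the right of 0 only, as is the case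
  for identities in \<open>q = 1 - p\<close> with a probability \<open>p\<close>.
\<close>

lemma powser_eq_on_unit_interval:
  fixes a b :: "nat \<Rightarrow> real"
  assumes a: "\<And>q. 0 < q \<Longrightarrow> q < 1 \<Longrightarrow> (\<lambda>j. a j * q ^ j) sums f q"
    and b: "\<And>q. 0 < q \<Longrightarrow> q < 1 \<Longrightarrow> (\<lambda>j. b j * q ^ j) sums f q"
  shows "a j = b j"
proof (rule ccontr)
  assume neq: "a j \<noteq> b j"
  \<comment> \<open>Multiplying the difference of the series by \<open>q\<close> makes it vanish at 0, so that zeros which
    accumulate at 0 contradict isolation of the zero at 0.\<close>
  define c where "c = (\<lambda>i. case i of 0 \<Rightarrow> 0 | Suc i \<Rightarrow> a i - b i)"
  define h where "h q = (\<Sum>i. c i * q ^ i)" for q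
  have pos: "(\<lambda>i. c i * q ^ i) sums 0" if "0 < q" "q < 1" for q
  proof -
    have "(\<lambda>i. q * (a i * q ^ i - b i * q ^ i)) sums (q * (f q - f q))"
      using that a b by (intro sums_mult sums_diff) auto
    then have "(\<lambda>i. c (Suc i) * q ^ Suc i) sums 0"
      by (simp add: c_def algebra_simps)
    then show ?thesis by (subst (asm) sums_Suc_iff) (simp add: c_def)
  qed
  have sm: "(\<lambda>i. c i * (q - 0) ^ i) sums h q" if q: "norm (q - 0) < 1" for q
  proof -
    obtain y where y: "norm q < y" "y < 1" using dense[of "norm q" 1] q unfolding diff_zero by blast
    then have "0 < y" using norm_ge_zero[of q] by linarith
    then have "summable (\<lambda>i. c i * q ^ i)"
      using y pos[of y] by (intro powser_inside[of c y q]) (auto simp: sums_iff)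
    then show ?thesis by (simp add: h_def sums_iff)
  qed
  have "h 0 = 0" by (simp add: h_def c_def)
  moreover have "c (Suc j) \<noteq> 0" using neq by (simp add: c_def)
  ultimately obtain s where s: "0 < s" "\<And>z. z \<in> cball 0 s - {0} \<Longrightarrow> h z \<noteq> 0"
    using powser_0_nonzero[of 1 0 c h "Suc j"] sm by auto
  define z where "z = min s (1/2)"
  have "h z \<noteq> 0" using s by (intro s(2)) (auto simp: z_def)
  moreover have "h z = 0" using pos[of z] s(1) by (auto simp: h_def sums_iff z_def)
  ultimately show False by simp
qed

section \<open>The recurrence and thinning\<close>

text \<open>
  The recurrence solved in closed form from an arbitrary starting index \<open>l\<close>: thinning uses it at every \<open>l \<ge> m\<close>, the asymptotics at \<open>l = m\<close>.
\<close>

lemma recurrence_pochhammer: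
  fixes d :: "nat \<Rightarrow> real"
  assumes rec: "\<And>k. k \<ge> m \<Longrightarrow> (real k + 1) * d (k + 1) = (real k - \<alpha>) * d k" and "m \<le> l"
  shows "d (l + j) * pochhammer (real l + 1) j = d l * pochhammer (real l - \<alpha>) j"
proof (induction j)
  case (Suc j)
  have "d (l + Suc j) * pochhammer (real l + 1) (Suc j) =
      ((real (l + j) + 1) * d (l + j + 1)) * pochhammer (real l + 1) j"
    by (simp add: pochhammer_Suc algebra_simps)
  also have "\<dots> = (real (l + j) - \<alpha>) * (d (l + j) * pochhammer (real l + 1) j)"
    using \<open>m \<le> l\<close> by (subst rec) simp_all
  also have "\<dots> = d l * pochhammer (real l - \<alpha>) (Suc j)"
    by (subst Suc.IH) (simp add: pochhammer_Suc algebra_simps)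
  finally show ?case .
qed simp

text \<open>This is the general binomial series, written with rising instead of falling factorials.\<close>

lemma negative_binomial_sums:
  fixes a q :: real
  assumes "\<bar>q\<bar> < 1"
  shows "(\<lambda>j. pochhammer a j / fact j * q ^ j) sums (1 - q) powr (- a)"
proof -
  have "(\<lambda>j. (- a gchoose j) * (- q) ^ j) sums (1 + - q) powr (- a)"
    using assms by (intro gen_binomial_real) simp
  moreover have "(- a gchoose j) * (- q) ^ j = pochhammer a j / fact j * q ^ j" for j
  proof -
    have "(- a gchoose j) * (- q) ^ j = pochhammer a j / fact j * ((- 1) ^ j * (- q) ^ j)"
      by (simp add: gbinomial_pochhammer)
    also have "(- 1) ^ j * (- q) ^ j = q ^ j"
      by (simp only: power_mult_distrib[symmetric]) simp
    finally show ?thesis .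
  qed
  ultimately show ?thesis by simp
qed

lemma choose_eq_pochhammer: "real ((l + j) choose l) = pochhammer (real l + 1) j / fact j"
proof -
  have "real ((l + j) choose l) = fact (l + j) / (fact l * fact j)"
    by (simp add: binomial_fact)
  also have "fact (l + j) = (fact l * pochhammer (real l + 1) j :: real)"
    using pochhammer_product'[of "1 :: real" l j] by (simp add: pochhammer_fact add.commute)
  finally show ?thesis by simp
qed

text \<open>
  The summand is the binomial weight of the event that thinning takes \<open>n\<close> to \<open>l\<close>. After a shift by
  \<open>l\<close>, the numerator of \<open>l + j choose l\<close> cancels the denominator in the solution of the recurrence. What
  remains is a negative binomial series with sum \<open>p powr (\<alpha> - l)\<close>, to be multiplied by \<open>p ^ l\<close>.
\<close>

lemma thinned_recurrence_sums:
  fixes d :: "nat \<Rightarrow> real"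
  assumes rec: "\<And>k. k \<ge> m \<Longrightarrow> (real k + 1) * d (k + 1) = (real k - \<alpha>) * d k"
    and p: "0 < p" "p < 1" and l: "m \<le> l"
  shows "(\<lambda>n. d n * (real (n choose l) * p ^ l * (1 - p) ^ (n - l))) sums (p powr \<alpha> * d l)"
proof -
  let ?f = "\<lambda>n. d n * (real (n choose l) * p ^ l * (1 - p) ^ (n - l))"
  have "(\<lambda>j. d l * p ^ l * (pochhammer (real l - \<alpha>) j / fact j * (1 - p) ^ j))
      sums (d l * p ^ l * (1 - (1 - p)) powr (- (real l - \<alpha>)))"
    using p by (intro sums_mult negative_binomial_sums) auto
  moreover have "d l * p ^ l * (pochhammer (real l - \<alpha>) j / fact j * (1 - p) ^ j) =
      ?f (j + l)" for j
    using recurrence_pochhammer[where l=l and j=j, OF rec l]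
    by (simp add: choose_eq_pochhammer add.commute[of j l])
  moreover have "p ^ l * (1 - (1 - p)) powr (- (real l - \<alpha>)) = p powr \<alpha>"
    using p by (simp add: powr_realpow[symmetric] flip: powr_add)
  ultimately have "(\<lambda>j. ?f (j + l)) sums (p powr \<alpha> * d l)"
    by (simp add: mult_ac)
  then show ?thesis
    by (rule sums_zero_iff_shift[THEN iffD1, rotated]) simp
qed

text \<open>
  The hypothesis evaluates the series \<open>G\<^sub>l\<close> with coefficients \<open>g l j\<close> as
  \<open>c (1 - q) * d l / (1 - q) ^ l\<close>. Hence \<open>d m * (1 - q) * G\<^bsub>m+1\<^esub>\<close> and \<open>d (m + 1) * G\<^sub>m\<close> are the same
  function, whatever \<open>c\<close> is, and the \<open>(k - m)\<close>-th coefficients of the two series agree.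
\<close>

lemma recurrence_of_thinned_proportional:
  fixes d :: "nat \<Rightarrow> real" and c :: "real \<Rightarrow> real"
  assumes dm: "d m > 0"
    and proportional: "\<And>p l. 0 < p \<Longrightarrow> p < 1 \<Longrightarrow> m \<le> l \<Longrightarrow>
      (\<lambda>n. d n * (real (n choose l) * p ^ l * (1 - p) ^ (n - l))) sums (c p * d l)"
    and k: "k \<ge> m"
  shows "(real k + 1) * d (k + 1) = (real k - (real m - (real m + 1) * d (m + 1) / d m)) * d k"
proof -
  define g where "g l j = d (l + j) * real ((l + j) choose l)" for l j
  have G: "(\<lambda>j. g l j * q ^ j) sums (c (1 - q) * d l / (1 - q) ^ l)"
    if q: "0 < q" "q < 1" and l: "m \<le> l" for q l
  proof -
    let ?f = "\<lambda>n. d n * (real (n choose l) * (1 - q) ^ l * q ^ (n - l))"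
    have "?f sums (c (1 - q) * d l)"
      using proportional[of "1 - q" l] q l by simp
    then have "(\<lambda>j. ?f (j + l)) sums (c (1 - q) * d l)"
      by (rule sums_zero_iff_shift[THEN iffD2, rotated]) simp
    moreover have "?f (j + l) / (1 - q) ^ l = g l j * q ^ j" for j
      using q by (simp add: g_def add.commute[of l j])
    ultimately show ?thesis
      using sums_divide[of "\<lambda>j. ?f (j + l)" _ "(1 - q) ^ l"] by simp
  qed
  \<comment> \<open>The coefficients of \<open>q * G\<^bsub>m+1\<^esub>(q)\<close>.\<close>
  define s where "s j = (case j of 0 \<Rightarrow> 0 | Suc i \<Rightarrow> g (m + 1) i)" for j
  define F where "F q = c (1 - q) * d m * d (m + 1) / (1 - q) ^ m" for q
  have "d m * (g (m + 1) j - s j) = d (m + 1) * g m j" for j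
  proof (rule powser_eq_on_unit_interval)
    fix q :: real assume q: "0 < q" "q < 1"
    let ?G = "c (1 - q) * d (m + 1) / (1 - q) ^ (m + 1)"
    have g: "(\<lambda>j. g (m + 1) j * q ^ j) sums ?G"
      using G[OF q, of "m + 1"] by simp
    from sums_mult[OF this, of q] have "(\<lambda>j. s (Suc j) * q ^ Suc j) sums (q * ?G)"
      by (simp add: s_def mult_ac)
    then have "(\<lambda>j. s j * q ^ j) sums (q * ?G)"
      by (subst (asm) sums_Suc_iff) (simp add: s_def)
    from sums_mult[OF sums_diff[OF g this], of "d m"]
    have "(\<lambda>j. d m * (g (m + 1) j - s j) * q ^ j) sums (d m * (?G - q * ?G))"
      by (simp add: algebra_simps)
    also have "d m * (?G - q * ?G) = d m * ((1 - q) * ?G)"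
      by (simp only: left_diff_distrib mult_1)
    also have "(1 - q) * ?G = c (1 - q) * d (m + 1) / (1 - q) ^ m"
      using q by simp
    also have "d m * \<dots> = F q" by (simp add: F_def)
    finally show "(\<lambda>j. d m * (g (m + 1) j - s j) * q ^ j) sums F q" .
    show "(\<lambda>j. d (m + 1) * g m j * q ^ j) sums F q"
      using sums_mult[OF G[OF q, of m], of "d (m + 1)"] by (simp add: F_def mult_ac)
  qed
  note coeff = this[of "k - m"]
  have s: "s (k - m) = d k * real (k choose (m + 1))"
  proof (cases "k - m")
    case 0
    then show ?thesis using k by (simp add: s_def binomial_eq_0)
  next
    case (Suc i)
    then have "k = m + 1 + i" using k by simp
    then show ?thesis by (simp only: s_def g_def) simp
  qed
  \<comment> \<open>All binomial coefficients in the coefficient identity are rational multiples of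
    \<open>k choose m\<close>, which can then be cancelled.\<close>
  define b C1 C2 where "b = real (k choose m)" and "C1 = real ((k + 1) choose (m + 1))"
    and "C2 = real (k choose (m + 1))"
  note defs = this
  have b: "b > 0" using k by (simp add: b_def)
  have "real (Suc k) * real (k choose m) = real (Suc k choose Suc m) * real (Suc m)"
    using Suc_times_binomial_eq[of k m] by (metis of_nat_mult)
  then have C1: "(real m + 1) * C1 = (real k + 1) * b"
    unfolding defs by (metis Suc_eq_plus1 mult.commute of_nat_1 of_nat_add)
  have "C2 = C1 - b" by (simp add: defs)
  then have "(real m + 1) * C2 = (real m + 1) * C1 - (real m + 1) * b"
    by (simp only: right_diff_distrib)
  also have "\<dots> = (real k - real m) * b"
    unfolding C1 by (simp only: left_diff_distrib distrib_right add_diff_cancel_right)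
  finally have C2: "(real m + 1) * C2 = (real k - real m) * b" .
  have coeff': "d m * (d (k + 1) * C1 - d k * C2) = d (m + 1) * (d k * b)"
  proof -
    have "g (m + 1) (k - m) = d (k + 1) * C1" "g m (k - m) = d k * b"
      using k by (simp_all add: g_def defs del: binomial_Suc_Suc)
    with coeff show ?thesis by (simp only: s C2_def)
  qed
  have "b * (d m * ((real k + 1) * d (k + 1) - (real k - real m) * d k)) =
      d m * (d (k + 1) * ((real m + 1) * C1) - d k * ((real m + 1) * C2))"
    unfolding C1 C2 by (simp add: algebra_simps)
  also have "\<dots> = (real m + 1) * (d m * (d (k + 1) * C1 - d k * C2))"
    by (simp add: algebra_simps)
  also have "\<dots> = b * (d k * ((real m + 1) * d (m + 1)))"
    unfolding coeff' by simp
  finally have "d m * ((real k + 1) * d (k + 1) - (real k - real m) * d k) =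
      d k * ((real m + 1) * d (m + 1))"
    using b by simp
  then have "(real k + 1) * d (k + 1) - (real k - real m) * d k =
      d k * ((real m + 1) * d (m + 1)) / d m"
    using dm by (simp add: eq_divide_eq mult.commute)
  then show ?thesis
    by (simp add: algebra_simps)
qed

section \<open>Consequences of the recurrence\<close>

text \<open>
  If \<open>\<alpha> \<le> 0\<close>, then \<open>k * d k\<close> is nondecreasing for \<open>k \<ge> m\<close>, so \<open>d k\<close> is at least of order \<open>1 / k\<close>.
\<close>

lemma recurrence_pos_exponent:
  fixes d :: "nat \<Rightarrow> real"
  assumes rec: "\<And>k. k \<ge> m \<Longrightarrow> (real k + 1) * d (k + 1) = (real k - \<alpha>) * d k"
    and m: "0 < m" and dm: "d m > 0" and nonneg: "\<And>k. d k \<ge> 0" and summ: "summable d"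
  shows "\<alpha> > 0"
proof (rule ccontr)
  assume "\<not> \<alpha> > 0"
  have lower: "real m * d m \<le> real k * d k" if "k \<ge> m" for k
    using that
  proof (induction k rule: dec_induct)
    case (step k)
    have "real k * d k \<le> (real k - \<alpha>) * d k"
      using \<open>\<not> \<alpha> > 0\<close> nonneg by (intro mult_right_mono) auto
    also have "\<dots> = real (Suc k) * d (Suc k)" using rec[OF step(1)] by (simp add: add.commute)
    finally show ?case using step by simp
  qed simp
  have "summable (\<lambda>k. real m * d m * inverse (real k))"
  proof (rule summable_comparison_test_ev)
    show "\<forall>\<^sub>F k in sequentially. norm (real m * d m * inverse (real k)) \<le> d k"
      using eventually_ge_at_top[of m]
    proof eventually_elim
      case (elim k)
      then show ?case using lower[OF elim] m dm by (simp add: field_simps)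
    qed
  qed (rule summ)
  then have "summable (\<lambda>k. inverse (real k))"
    using m dm by (subst (asm) summable_cmult_iff) auto
  then show False using not_summable_harmonic[where 'a=real] by simp
qed

text \<open>
  The solution of the recurrence is a quotient of Pochhammer symbols with first arguments
  \<open>r = m - \<alpha>\<close> and \<open>m + 1\<close>. Euler's sequence \<open>j! * j powr z / pochhammer z (j + 1)\<close> tends to
  \<open>Gamma z\<close>, so this quotient is asymptotic to a constant times \<open>j powr (r - (m + 1))\<close>, and the
  exponent equals \<open>- (\<alpha> + 1)\<close>.
\<close>

lemma recurrence_power_law:
  fixes d :: "nat \<Rightarrow> real"
  assumes rec: "\<And>k. k \<ge> m \<Longrightarrow> (real k + 1) * d (k + 1) = (real k - \<alpha>) * d k"
    and \<alpha>: "\<alpha> < real m" and dm: "d m > 0"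
  shows "\<exists>c>0. d \<sim>[at_top] (\<lambda>k. c * real k powr (- (\<alpha> + 1)))"
proof -
  define r where "r = real m - \<alpha>"
  have r: "r > 0" using \<alpha> by (simp add: r_def)
  define c where "c = d m * (Gamma (real m + 1) / Gamma r)"
  have c: "c > 0" using dm r by (simp add: c_def)
  \<comment> \<open>The shift is \<open>m + 1\<close> rather than \<open>m\<close> because the \<open>j\<close>-th term of Euler's sequence involves
    \<open>pochhammer z (j + 1)\<close>.\<close>
  have eq: "d (j + (m + 1)) / real (j + (m + 1)) powr (- (\<alpha> + 1)) =
      d m * (Gamma_series (real m + 1) j / Gamma_series r j) *
        (real j / real (j + (m + 1))) powr (- (\<alpha> + 1))" if "j > 0" for j
  proof -
    have pos: "pochhammer (real m + 1) (j + 1) > 0" "pochhammer r (j + 1) > 0"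
      using r by (auto intro!: pochhammer_pos)
    have "d (j + (m + 1)) * pochhammer (real m + 1) (j + 1) = d m * pochhammer r (j + 1)"
      using recurrence_pochhammer[of m d \<alpha> m "j + 1", OF rec] by (simp add: r_def add_ac)
    then have d: "d (j + (m + 1)) = d m * (pochhammer r (j + 1) / pochhammer (real m + 1) (j + 1))"
      using pos by (simp add: field_simps)
    have "Gamma_series (real m + 1) j / Gamma_series r j =
        pochhammer r (j + 1) / pochhammer (real m + 1) (j + 1) * real j powr (real m + 1 - r)"
      using that by (simp add: Gamma_series_def powr_def exp_diff algebra_simps)
    also have "real m + 1 - r = \<alpha> + 1" by (simp add: r_def)
    finally have ratio: "Gamma_series (real m + 1) j / Gamma_series r j =
        pochhammer r (j + 1) / pochhammer (real m + 1) (j + 1) * real j powr (\<alpha> + 1)" .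
    have "real j powr (\<alpha> + 1) * (real j / real (j + (m + 1))) powr (- (\<alpha> + 1)) =
        1 / real (j + (m + 1)) powr (- (\<alpha> + 1))"
      using that by (simp only: powr_divide of_nat_0_le_iff powr_minus) (simp add: inverse_eq_divide)
    then show ?thesis
      unfolding d ratio by (simp only: mult.assoc) simp
  qed
  have "(\<lambda>j. d m * (Gamma_series (real m + 1) j / Gamma_series r j) *
      (real j / real (j + (m + 1))) powr (- (\<alpha> + 1))) \<longlonglongrightarrow> c * 1 powr (- (\<alpha> + 1))"
    unfolding c_def
  proof (intro tendsto_intros)
    show "Gamma r \<noteq> 0" using r Gamma_real_pos[of r] by linarith
    show "(\<lambda>j. real j / real (j + (m + 1))) \<longlonglongrightarrow> 1" by real_asymp
  qed auto
  then have "(\<lambda>j. d (j + (m + 1)) / real (j + (m + 1)) powr (- (\<alpha> + 1))) \<longlonglongrightarrow> c"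
    using eq by (subst tendsto_cong[OF eventually_mono[OF eventually_gt_at_top[of 0]]]) auto
  then have "(\<lambda>k. d k / real k powr (- (\<alpha> + 1))) \<longlonglongrightarrow> c"
    by (rule LIMSEQ_offset)
  then have "d \<sim>[at_top] (\<lambda>k. c * real k powr (- (\<alpha> + 1)))"
    using c by (intro asymp_equivI'_const) auto
  with c show ?thesis by blast
qed

section \<open>Distributions fixed by all thinnings\<close>

lemma sum_le_sums_nonneg:
  fixes f :: "nat \<Rightarrow> real"
  assumes "f sums s" "\<And>n. f n \<ge> 0" "finite I"
  shows "sum f I \<le> s"
  using assms sum_le_suminf[of f I] by (auto simp: sums_iff)

text \<open>
  The two directions combine the analytic lemmas with the probabilistic description of fixed points.
  For the step from the recurrence to the fixed point, \<open>P(S\<^sub>D = l) = p powr \<alpha> * d l\<close> summed over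
  \<open>l \<ge> m\<close> identifies the normalising constant as \<open>p powr \<alpha>\<close>, because \<open>d\<close> has total mass 1 there.
  Constant \<open>D = m\<close> is included as the case \<open>\<alpha> = m\<close>.
\<close>

lemma thinning_fixed_iff_recurrence:
  fixes M :: "'a measure" and D :: "'a \<Rightarrow> nat"
  defines "d \<equiv> \<lambda>n. \<P>(\<omega> in M. D \<omega> = n)"
  assumes M: "prob_space M" and D: "D \<in> M \<rightarrow>\<^sub>M count_space UNIV"
    and pos: "\<P>(\<omega> in M. D \<omega> \<ge> m) > 0"
  shows "(\<forall>p. 0 < p \<and> p < 1 \<longrightarrow> T_distr p m M D = distr M (count_space UNIV) D) \<longleftrightarrow>
    (\<forall>l<m. d l = 0) \<and> d m > 0 \<and>
    (\<exists>\<alpha>\<le>real m. \<forall>k\<ge>m. (real k + 1) * d (k + 1) = (real k - \<alpha>) * d k)"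
proof -
  interpret M: prob_space M by fact
  note [measurable] = D
  define S where "S p l = \<P>(x in thinning_space M p. thinning D x = l)" for p l
  define c where "c p = \<P>(x in thinning_space M p. thinning D x \<ge> m)" for p
  let ?t = "\<lambda>p l n. d n * (real (n choose l) * p ^ l * (1 - p) ^ (n - l))"
  have S: "?t p l sums S p l" if "0 < p" "p < 1" for p l
    unfolding S_def d_def using that by (intro thinning_sums[OF M D]) auto
  have c: "(\<lambda>j. S p (m + j)) sums c p" for p
    unfolding S_def c_def
    by (intro prob_ge_sums prob_space_thinning_space measurable_thinning M D)
  have d_nonneg: "d n \<ge> 0" for n by (simp add: d_def)
  have d_ge: "(\<lambda>j. d (m + j)) sums \<P>(\<omega> in M. D \<omega> \<ge> m)"
    unfolding d_def by (rule prob_ge_sums[OF M D])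
  \<comment> \<open>A value \<open>n \<ge> m\<close> of positive probability can be thinned to every \<open>l \<le> n\<close>. This makes the
    conditioning event non-null and, taking \<open>l = m\<close>, forces \<open>d m > 0\<close> at a fixed point.\<close>
  obtain n where n: "n \<ge> m" "d n > 0"
  proof (rule ccontr)
    assume "\<not> thesis"
    with that have "d (m + j) = 0" for j
      using d_nonneg[of "m + j"] by (metis le_add1 less_eq_real_def)
    with d_ge have "(\<lambda>j. 0) sums \<P>(\<omega> in M. D \<omega> \<ge> m)" by simp
    then have "\<P>(\<omega> in M. D \<omega> \<ge> m) = 0" by (rule sums_unique2) simp
    with pos show False by simp
  qed
  have S_pos: "S p l > 0" if "0 < p" "p < 1" "l \<le> n" for p l
  proof -
    have "0 < ?t p l n" using n that by simp
    also have "\<dots> \<le> S p l"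
      using sum_le_sums_nonneg[OF S[of p l], of "{n}"] that d_nonneg by simp
    finally show ?thesis .
  qed
  have c_pos: "c p > 0" if "0 < p" "p < 1" for p
  proof -
    have "0 < S p (m + (n - m))" using S_pos n that by simp
    also have "\<dots> \<le> c p"
      using sum_le_sums_nonneg[OF c[of p], of "{n - m}"] by (simp add: S_def)
    finally show ?thesis .
  qed
  have fixed: "T_distr p m M D = distr M (count_space UNIV) D \<longleftrightarrow>
      (\<forall>l<m. d l = 0) \<and> (\<forall>l\<ge>m. S p l = c p * d l)" if "0 < p" "p < 1" for p
    using thinning_fixed_iff[OF M D, of p m] c_pos[OF that] by (simp add: S_def c_def d_def)
  show ?thesis (is "?L \<longleftrightarrow> ?R")
  proof
    assume ?L
    then have d0: "\<forall>l<m. d l = 0" using fixed[of "1/2"] by simp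
    have Sc: "S p l = c p * d l" if "0 < p" "p < 1" "l \<ge> m" for p l
      using \<open>?L\<close> fixed that by blast
    have "0 < c (1/2) * d m"
      using S_pos[of "1/2" m] Sc[of "1/2" m] n by simp
    then have dm: "d m > 0"
      using c_pos[of "1/2"] by (simp add: zero_less_mult_iff)
    define \<alpha> where "\<alpha> = real m - (real m + 1) * d (m + 1) / d m"
    have "\<alpha> \<le> real m" using dm d_nonneg[of "m + 1"] by (simp add: \<alpha>_def)
    moreover have "(real k + 1) * d (k + 1) = (real k - \<alpha>) * d k" if "k \<ge> m" for k
    proof -
      have "?t p l sums (c p * d l)" if "0 < p" "p < 1" "l \<ge> m" for p l
        using S[OF that(1,2), of l] Sc[OF that] by simp
      from recurrence_of_thinned_proportional[OF dm this \<open>k \<ge> m\<close>] show ?thesis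
        by (simp only: \<alpha>_def)
    qed
    ultimately show ?R using d0 dm by blast
  next
    assume ?R
    then obtain \<alpha> where d0: "\<And>l. l < m \<Longrightarrow> d l = 0"
      and rec: "\<And>k. k \<ge> m \<Longrightarrow> (real k + 1) * d (k + 1) = (real k - \<alpha>) * d k"
      by blast
    have S_eq: "S p l = p powr \<alpha> * d l" if "0 < p" "p < 1" "l \<ge> m" for p l
      using S[of p l] thinned_recurrence_sums[where d=d and \<alpha>=\<alpha> and m=m and p=p and l=l, OF rec] that
      by (auto intro: sums_unique2)
    have "(\<lambda>j. d (0 + j)) sums \<P>(\<omega> in M. D \<omega> \<ge> 0)"
      unfolding d_def by (rule prob_ge_sums[OF M D])
    then have "d sums 1" using M.prob_space by simp
    then have "(\<lambda>j. d (j + m)) sums 1"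
      using d0 by (subst sums_zero_iff_shift)
    then have total: "(\<lambda>j. d (m + j)) sums 1" by (simp add: add.commute)
    have "c p = p powr \<alpha>" if "0 < p" "p < 1" for p
    proof -
      have "(\<lambda>j. S p (m + j)) sums (p powr \<alpha> * 1)"
        using sums_mult[OF total, of "p powr \<alpha>"] that by (simp add: S_eq)
      with c[of p] show ?thesis by (simp add: sums_unique2)
    qed
    then show ?L using fixed S_eq d0 by simp
  qed
qed

theorem theorem1:
  fixes M :: "'a measure" and D :: "'a \<Rightarrow> nat" and m :: nat
  assumes "prob_space M"
    and "D \<in> M \<rightarrow>\<^sub>M count_space UNIV"
    and "m > 0"
    and "\<P>(\<omega> in M. D \<omega> \<ge> m) > 0"
  shows "(\<forall>p. 0 < p \<and> p < 1 \<longrightarrow> T_distr p m M D = distr M (count_space UNIV) D) \<longleftrightarrow>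
    (\<P>(\<omega> in M. D \<omega> = m) = 1 \<or>
     (\<exists>\<alpha> \<beta> :: real. 0 < \<alpha> \<and> \<alpha> < real m \<and> \<beta> = \<alpha> + 1 \<and>
        has_power_law M D \<beta> \<and>
        \<P>(\<omega> in M. D \<omega> < m) = 0 \<and>
        (\<forall>k\<ge>m. \<P>(\<omega> in M. D \<omega> = k + 1) / \<P>(\<omega> in M. D \<omega> = k)
                = (real k - \<alpha>) / (real k + 1))))"
proof -
  interpret prob_space M by fact
  note [measurable] = assms(2)
  define d where "d n = \<P>(\<omega> in M. D \<omega> = n)" for n
  have d_nonneg: "d n \<ge> 0" for n by (simp add: d_def)
  have "(\<lambda>j. d (0 + j)) sums \<P>(\<omega> in M. D \<omega> \<ge> 0)"
    unfolding d_def by (rule prob_ge_sums[OF assms(1,2)])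
  then have d_sums: "d sums 1" using prob_space by simp
  have less_iff: "\<P>(\<omega> in M. D \<omega> < m) = 0 \<longleftrightarrow> (\<forall>l<m. d l = 0)"
  proof -
    have "{\<omega> \<in> space M. D \<omega> < m} = (\<Union>l<m. {\<omega> \<in> space M. D \<omega> = l})" by auto
    then have "\<P>(\<omega> in M. D \<omega> < m) = (\<Sum>l<m. d l)"
      unfolding d_def
      by (simp only:) (intro finite_measure_finite_Union, auto simp: disjoint_family_on_def)
    then show ?thesis using d_nonneg by (auto simp: sum_nonneg_eq_0_iff)
  qed
  let ?rec = "\<lambda>\<alpha>. \<forall>k\<ge>m. (real k + 1) * d (k + 1) = (real k - \<alpha>) * d k"
  let ?ratio = "\<lambda>\<alpha>. \<forall>k\<ge>m. d (k + 1) / d k = (real k - \<alpha>) / (real k + 1)"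
  have "(\<forall>p. 0 < p \<and> p < 1 \<longrightarrow> T_distr p m M D = distr M (count_space UNIV) D) \<longleftrightarrow>
      (\<forall>l<m. d l = 0) \<and> d m > 0 \<and> (\<exists>\<alpha>\<le>real m. ?rec \<alpha>)"
    unfolding d_def using assms by (intro thinning_fixed_iff_recurrence)
  also have "\<dots> \<longleftrightarrow> d m = 1 \<or> (\<exists>\<alpha> \<beta>. 0 < \<alpha> \<and> \<alpha> < real m \<and> \<beta> = \<alpha> + 1 \<and>
      has_power_law M D \<beta> \<and> (\<forall>l<m. d l = 0) \<and> ?ratio \<alpha>)" (is "?L \<longleftrightarrow> ?const \<or> ?power")
  proof
    assume ?L
    then obtain \<alpha> where d0: "\<forall>l<m. d l = 0" and dm: "d m > 0" and \<alpha>: "\<alpha> \<le> real m"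
      and rec: "\<And>k. k \<ge> m \<Longrightarrow> (real k + 1) * d (k + 1) = (real k - \<alpha>) * d k"
      by blast
    show "?const \<or> ?power"
    proof (cases "\<alpha> = real m")
      case True
      have "d (m + Suc j) = 0" for j
      proof (induction j)
        case 0
        have "real m + 1 > 0" by simp
        then show ?case using rec[of m] True by simp
      next
        case (Suc j)
        have "real (m + Suc j) + 1 > 0" by simp
        then show ?case using rec[of "m + Suc j"] Suc by simp
      qed
      then have "d n = 0" if "n \<noteq> m" for n
        using d0 that by (cases "n < m") (auto dest!: less_imp_Suc_add simp: not_less_iff_gr_or_eq)
      then have "d sums d m"
        using sums_finite[of "{m}" d] by simp
      with d_sums show ?thesis by (simp add: sums_unique2)
    next
      case False
      with \<alpha> have less: "\<alpha> < real m" by simp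
      have "\<alpha> > 0"
        using recurrence_pos_exponent[of m d, OF rec assms(3) dm d_nonneg] d_sums
        by (simp add: sums_iff)
      moreover have "has_power_law M D (\<alpha> + 1)"
        using recurrence_power_law[of m d, OF rec less dm]
        unfolding has_power_law_def d_def .
      moreover have d_pos: "d k > 0" if "k \<ge> m" for k
        using that
      proof (induction k rule: dec_induct)
        case (step k)
        then have "0 < (real k + 1) * d (k + 1)"
          using rec[OF step(1)] less by simp
        then show ?case by (simp add: zero_less_mult_iff)
      qed (rule dm)
      have "?ratio \<alpha>"
      proof (intro allI impI)
        fix k assume "k \<ge> m"
        then show "d (k + 1) / d k = (real k - \<alpha>) / (real k + 1)"
          using rec d_pos[of k] by (simp add: frac_eq_eq mult.commute)
      qed
      ultimately show ?thesis using less d0 by blast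
    qed
  next
    assume "?const \<or> ?power"
    then show ?L
    proof
      assume ?const
      have zero: "d n = 0" if "n \<noteq> m" for n
      proof -
        have "d n + d m = (\<Sum>i\<in>{n, m}. d i)" using that by simp
        also have "\<dots> \<le> 1"
          using d_sums d_nonneg by (rule sum_le_sums_nonneg) simp
        finally show ?thesis using \<open>?const\<close> d_nonneg[of n] by simp
      qed
      have "?rec (real m)"
      proof (intro allI impI)
        fix k assume "k \<ge> m"
        then show "(real k + 1) * d (k + 1) = (real k - real m) * d k"
          by (cases "k = m") (simp_all add: zero)
      qed
      moreover have "\<forall>l<m. d l = 0" "d m > 0" using zero \<open>?const\<close> by auto
      ultimately show ?L by blast
    next
      assume ?power
      then obtain \<alpha> where \<alpha>: "\<alpha> < real m" and d0: "\<forall>l<m. d l = 0"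
        and ratio: "\<And>k. k \<ge> m \<Longrightarrow> d (k + 1) / d k = (real k - \<alpha>) / (real k + 1)"
        by blast
      \<comment> \<open>If \<open>d k = 0\<close>, then the quotient is 0 since \<open>x / 0 = 0\<close>, but \<open>k - \<alpha> > 0\<close>.\<close>
      have nonzero: "d k \<noteq> 0" if "k \<ge> m" for k
        using ratio[OF that] \<alpha> that by auto
      have "?rec \<alpha>"
      proof (intro allI impI)
        fix k assume "k \<ge> m"
        then show "(real k + 1) * d (k + 1) = (real k - \<alpha>) * d k"
          using ratio nonzero by (simp add: frac_eq_eq mult.commute)
      qed
      moreover have "d m > 0" using nonzero[of m] d_nonneg[of m] by linarith
      moreover have "\<alpha> \<le> real m" using \<alpha> by simp
      ultimately show ?L using d0 by blast
    qed
  qed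
  finally show ?thesis by (simp only: less_iff d_def)
qed

end
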